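(* Let $\delta_1$ and $\delta_2$ be two positive integers. Let $G$ be a connected graph and let $V_0=\{v\in V(G): d_G(v)=\delta_1+\delta_2\}$. If $\delta(G)\ge \delta_1+\delta_2$, then $G$ can be edge-decomposed into two factors $G_1$ and $G_2$ satisfying $\delta(G_1)\ge \delta_1$ and $\delta(G_2)\ge \delta_2$, provided that one of the following conditions holds: (1) $\delta_1$ and $\delta_2$ are even; (2) $\delta_1$ is odd and $\delta_2$ is even, and $G$ is $V_0$-partially odd-$\lceil \frac{\delta_1+\delta_2}{\delta_1 }\rceil$-edge-connected; (3) $\delta_1$ and $\delta_2$ are odd, and ($|V(G)|$ is even or $V_0\neq V(G)$), and $G$ is $V_0$-partially odd-$( \lceil \frac{\delta_1+\delta_2}{\min \{\delta_1,\delta_2\} }\rceil, V_0)$-edge-connected.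
   Context: Graphs may have loops and multiple edges; $d_G(v)$ is the degree of $v$ in $G$ (a loop counts twice), and $\delta(G)$ is the minimum degree. A factor of $G$ is a spanning subgraph of $G$; $G$ is edge-decomposed into factors if their edge sets partition $E(G)$. For a vertex set $A$, $d_G(A)$ is the number of edges of $G$ with exactly one end in $A$. $G$ is $V_0$-partially odd-$\lambda$-edge-connected if $d_G(A)\ge \lambda$ for all nonempty subsets $A$ of $V_0$ with $d_G(A)$ odd. For a vertex set $Q$, $G$ is $V_0$-partially odd-$(\lambda, Q)$-edge-connected if $d_G(A)\ge \lambda$ for all subsets $A$ of $V_0$ with $|A\cap Q|$ odd. *)

theory Defs
  imports Complex_Main "HOL-Library.Uprod"
begin

text \<open>Undirected graphs with named edges: distinct edges may have the same ends (multiple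
  edges), and an edge with ends \<open>Upair v v\<close> is a loop at \<open>v\<close>.\<close>

record ('v, 'e) multigraph =
  verts :: "'v set"
  edges :: "'e set"
  ends :: "'e \<Rightarrow> 'v uprod"

locale fin_multigraph =
  fixes G :: "('v, 'e) multigraph"
  assumes finite_verts: "finite (verts G)"
    and finite_edges: "finite (edges G)"
    and ends_in_verts: "e \<in> edges G \<Longrightarrow> set_uprod (ends G e) \<subseteq> verts G"

definition adjacency :: "('v, 'e) multigraph \<Rightarrow> ('v \<times> 'v) set" where
  "adjacency G = {(u, v). \<exists>e\<in>edges G. ends G e = Upair u v}"

text \<open>A connected graph is nonempty by convention.\<close>

definition connected_graph :: "('v, 'e) multigraph \<Rightarrow> bool" where
  "connected_graph G \<longleftrightarrow>
     verts G \<noteq> {} \<and> (\<forall>u\<in>verts G. \<forall>v\<in>verts G. (u, v) \<in> (adjacency G)\<^sup>*)"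

text \<open>The second summand makes every loop at \<open>v\<close> count twice.\<close>

definition degree :: "('v, 'e) multigraph \<Rightarrow> 'v \<Rightarrow> nat" where
  "degree G v = card {e \<in> edges G. v \<in> set_uprod (ends G e)}
     + card {e \<in> edges G. ends G e = Upair v v}"

text \<open>Meaningful only for graphs with a finite nonempty vertex set.\<close>

definition min_degree :: "('v, 'e) multigraph \<Rightarrow> nat" where
  "min_degree G = Min (degree G ` verts G)"

text \<open>The number \<open>d\<^sub>G(A)\<close> of edges with exactly one end in \<open>A\<close>.\<close>

definition cut_degree :: "('v, 'e) multigraph \<Rightarrow> 'v set \<Rightarrow> nat" where
  "cut_degree G A = card {e \<in> edges G. \<exists>u w. ends G e = Upair u w \<and> u \<in> A \<and> w \<notin> A}"

text \<open>A factor is a spanning subgraph: same vertices, some of the edges, with unchanged ends.\<close>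

definition factor :: "('v, 'e) multigraph \<Rightarrow> ('v, 'e) multigraph \<Rightarrow> bool" where
  "factor H G \<longleftrightarrow> verts H = verts G \<and> edges H \<subseteq> edges G \<and>
     (\<forall>e\<in>edges H. ends H e = ends G e)"

definition edge_decomposed ::
  "('v, 'e) multigraph \<Rightarrow> ('v, 'e) multigraph \<Rightarrow> ('v, 'e) multigraph \<Rightarrow> bool" where
  "edge_decomposed G G1 G2 \<longleftrightarrow> factor G1 G \<and> factor G2 G \<and>
     edges G1 \<union> edges G2 = edges G \<and> edges G1 \<inter> edges G2 = {}"

definition partially_odd_edge_connected ::
  "('v, 'e) multigraph \<Rightarrow> 'v set \<Rightarrow> nat \<Rightarrow> bool" where
  "partially_odd_edge_connected G V0 l \<longleftrightarrow>
     (\<forall>A. A \<subseteq> V0 \<and> A \<noteq> {} \<and> odd (cut_degree G A) \<longrightarrow> cut_degree G A \<ge> l)"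

text \<open>The parity condition here is on \<open>|A \<inter> Q|\<close>, not on the size of the cut.\<close>

definition partially_odd_set_edge_connected ::
  "('v, 'e) multigraph \<Rightarrow> 'v set \<Rightarrow> nat \<Rightarrow> 'v set \<Rightarrow> bool" where
  "partially_odd_set_edge_connected G V0 l Q \<longleftrightarrow>
     (\<forall>A. A \<subseteq> V0 \<and> odd (card (A \<inter> Q)) \<longrightarrow> cut_degree G A \<ge> l)"

end

theory Submission
  imports Defs "HOL-Library.Disjoint_Sets"
begin

text \<open>Write \<open>a\<close> and \<open>b\<close> for the two required minimum degrees. It suffices to find a set \<open>F\<close> of edges
  with at least \<open>a\<close> edge ends in \<open>F\<close> and at least \<open>b\<close> outside at every vertex. Taking the fraction
  \<open>a / (a + b)\<close> of every edge is a fractional solution, since all degrees are at least \<open>a + b\<close>, and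
  only parity can prevent an integral one.

  The search for \<open>F\<close> is turned into a matching problem on the half-edges together with auxiliary
  core vertices, where certain cores may stay uncovered (locale \<open>split_gadget\<close>). By a version of Tutte's
  theorem (\<open>tutte_partial\<close>), a matching exists if deleting any set \<open>S\<close> leaves at most \<open>card S\<close>
  odd components that avoid the optional cores. This is shown by discharging
  (\<open>tutte_partial_weighted\<close>): the fractional solution defines weights with which each member of \<open>S\<close> gives
  at most 1, and it remains to see that each such odd component receives at least 1.

  Local counting settles all components except those that contain, for some
  nonempty set \<open>U\<close> of vertices of degree exactly \<open>a + b\<close>, all the cores of \<open>U\<close>
  (\<open>charges_full_vertices\<close>). Unless a single edge within \<open>U\<close> already brings it 1, such a component receives
  at least \<open>a / (a + b)\<close> through each of some number \<open>n1\<close> of the edges leaving \<open>U\<close> and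
  at least \<open>b / (a + b)\<close> through each of the \<open>n2\<close> others, and its being odd means that
  \<open>b * card U + n1\<close> is odd. If \<open>n1\<close> and \<open>n2\<close> are both positive, the sum is at least 1. If one of them
  is zero, then either parity rules this out, as it always does when \<open>a\<close> and \<open>b\<close> are even, or the
  assumed odd edge-connectivity applies to \<open>U\<close> and bounds the other one from
  below by what is needed.\<close>

section \<open>Hall's marriage theorem\<close>

text \<open>The argument of Halmos and Vaughan. If every proper nonempty subfamily has a surplus, any
  choice for one index leaves a family that still satisfies the condition. Otherwise a tight
  subfamily \<open>J\<close> is served first; the remaining indices still satisfy the condition after
  the elements used by \<open>J\<close> are removed, because adding \<open>J\<close> to a bad subfamily would violate
  the condition for the whole.\<close>

lemma hall_marriage:
  fixes N :: "'i \<Rightarrow> 'b set"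
  assumes "finite I" and "\<And>i. i \<in> I \<Longrightarrow> finite (N i)"
    and "\<And>J. J \<subseteq> I \<Longrightarrow> card J \<le> card (\<Union>i\<in>J. N i)"
  shows "\<exists>r. inj_on r I \<and> (\<forall>i\<in>I. r i \<in> N i)"
  using assms
proof (induction "card I" arbitrary: I N rule: less_induct)
  case less
  note fin = less.prems(1) and finN = less.prems(2) and hall = less.prems(3)
  show ?case
  proof (cases "I = {}")
    case False
    show ?thesis
    proof (cases "\<exists>J. J \<subset> I \<and> J \<noteq> {} \<and> card (\<Union>i\<in>J. N i) = card J")
      case True
      then obtain J where J: "J \<subset> I" "J \<noteq> {}" "card (\<Union>i\<in>J. N i) = card J" by blast
      define W where "W = (\<Union>i\<in>J. N i)"
      have finJ: "finite J" using J(1) fin by (meson finite_subset psubset_imp_subset)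
      have "\<exists>r. inj_on r J \<and> (\<forall>i\<in>J. r i \<in> N i)"
        using J fin finN hall by (intro less.hyps) (auto intro: psubset_card_mono finJ)
      then obtain r where r: "inj_on r J" "\<forall>i\<in>J. r i \<in> N i" by blast
      have "\<exists>r. inj_on r (I - J) \<and> (\<forall>i\<in>I - J. r i \<in> N i - W)"
      proof (intro less.hyps)
        show "card (I - J) < card I" using J(1,2) fin by (intro psubset_card_mono) auto
        show "finite (I - J)" "\<And>i. i \<in> I - J \<Longrightarrow> finite (N i - W)" using fin finN by auto
        fix L assume L: "L \<subseteq> I - J"
        have finL: "finite L" using L fin by (auto intro: finite_subset)
        have "card L + card J = card (L \<union> J)"
          using L finL finJ by (intro card_Un_disjoint[symmetric]) auto
        also have "\<dots> \<le> card (\<Union>i\<in>L \<union> J. N i)" using L J(1) by (intro hall) auto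
        also have "(\<Union>i\<in>L \<union> J. N i) = (\<Union>i\<in>L. N i - W) \<union> W" by (auto simp: W_def)
        also have "card \<dots> \<le> card (\<Union>i\<in>L. N i - W) + card W" by (rule card_Un_le)
        finally show "card L \<le> card (\<Union>i\<in>L. N i - W)" using J(3) by (simp add: W_def)
      qed
      then obtain q where q: "inj_on q (I - J)" "\<forall>i\<in>I - J. q i \<in> N i - W" by blast
      let ?f = "\<lambda>i. if i \<in> J then r i else q i"
      have rW: "r i \<in> W" if "i \<in> J" for i using r(2) that by (auto simp: W_def)
      have "inj_on ?f I"
      proof (rule inj_onI)
        fix i j assume ij: "i \<in> I" "j \<in> I" "?f i = ?f j"
        consider "i \<in> J" "j \<in> J" | "i \<in> J" "j \<notin> J" | "i \<notin> J" "j \<in> J" | "i \<notin> J" "j \<notin> J" by blast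
        then show "i = j"
        proof cases
          case 1
          then show ?thesis using ij r(1) by (simp add: inj_on_def)
        next
          case 2
          then show ?thesis using ij q(2) rW[of i] by auto
        next
          case 3
          then show ?thesis using ij q(2) rW[of j] by (metis Diff_iff)
        next
          case 4
          then show ?thesis using ij q(1) by (simp add: inj_on_def)
        qed
      qed
      moreover have "\<forall>i\<in>I. ?f i \<in> N i" using r q by auto
      ultimately show ?thesis by blast
    next
      case False
      have surplus: "card J < card (\<Union>i\<in>J. N i)" if "J \<subset> I" "J \<noteq> {}" for J
        using False that hall[of J] by (metis le_neq_implies_less psubset_imp_subset)
      obtain k where k: "k \<in> I" using \<open>I \<noteq> {}\<close> by blast
      have "card {k} \<le> card (N k)" using hall[of "{k}"] k by simp
      then obtain y where y: "y \<in> N k" by fastforce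
      have "\<exists>r. inj_on r (I - {k}) \<and> (\<forall>i\<in>I - {k}. r i \<in> N i - {y})"
      proof (intro less.hyps)
        show "card (I - {k}) < card I" using k fin by (intro psubset_card_mono) auto
        show "finite (I - {k})" "\<And>i. i \<in> I - {k} \<Longrightarrow> finite (N i - {y})" using fin finN by auto
        fix L assume L: "L \<subseteq> I - {k}"
        have eq: "(\<Union>i\<in>L. N i - {y}) = (\<Union>i\<in>L. N i) - {y}" by auto
        show "card L \<le> card (\<Union>i\<in>L. N i - {y})"
        proof (cases "L = {}")
          case False
          then have "card L < card (\<Union>i\<in>L. N i)" using L k by (intro surplus) auto
          then show ?thesis unfolding eq by (simp add: card_Diff_singleton_if) linarith
        qed simp
      qed
      then obtain q where q: "inj_on q (I - {k})" "\<forall>i\<in>I - {k}. q i \<in> N i - {y}" by blast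
      have "inj_on (q(k := y)) I" using q by (auto simp: inj_on_def)
      moreover have "\<forall>i\<in>I. (q(k := y)) i \<in> N i" using q y by auto
      ultimately show ?thesis by blast
    qed
  qed simp
qed

section \<open>Matchings that may miss a prescribed set of vertices\<close>

text \<open>\<open>K\<close> is the set of vertices that a matching is free to miss.\<close>

locale partly_covered_graph =
  fixes adj :: "'a \<Rightarrow> 'a \<Rightarrow> bool" and K :: "'a set"
  assumes adj_sym: "adj u v \<Longrightarrow> adj v u"
begin

text \<open>Components are obtained without paths, as the atoms of the Boolean algebra of vertex sets that
  no edge inside \<open>X\<close> leaves. Restriction to a closed set and deletion of vertices then reduce to
  elementary set algebra.\<close>

definition closed_in :: "'a set \<Rightarrow> 'a set \<Rightarrow> bool" where
  "closed_in X Y \<longleftrightarrow> Y \<subseteq> X \<and> (\<forall>u\<in>Y. \<forall>w\<in>X. adj u w \<longrightarrow> w \<in> Y)"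

definition comps :: "'a set \<Rightarrow> 'a set set" where
  "comps X = {C. C \<noteq> {} \<and> closed_in X C \<and> (\<forall>Y\<subseteq>C. closed_in X Y \<longrightarrow> Y = {} \<or> Y = C)}"

text \<open>Only components that avoid \<open>K\<close> are counted: any other component can restore the parity by
  missing a vertex.\<close>

definition odd_comps :: "'a set \<Rightarrow> 'a set set" where
  "odd_comps X = {C \<in> comps X. odd (card C) \<and> C \<inter> K = {}}"

lemma compsI:
  "C \<noteq> {} \<Longrightarrow> closed_in X C \<Longrightarrow> (\<And>Y. Y \<subseteq> C \<Longrightarrow> closed_in X Y \<Longrightarrow> Y \<noteq> {} \<Longrightarrow> Y = C) \<Longrightarrow> C \<in> comps X"
  unfolding comps_def by blast

lemma compsD:
  assumes "C \<in> comps X"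
  shows "C \<noteq> {}" "closed_in X C" "C \<subseteq> X"
    "\<And>Y. Y \<subseteq> C \<Longrightarrow> closed_in X Y \<Longrightarrow> Y \<noteq> {} \<Longrightarrow> Y = C"
  using assms unfolding comps_def closed_in_def by blast+

lemma closed_in_compl: "closed_in X C \<Longrightarrow> closed_in X (X - C)"
  unfolding closed_in_def using adj_sym by blast

lemma closed_in_Int: "closed_in X C \<Longrightarrow> closed_in X D \<Longrightarrow> closed_in X (C \<inter> D)"
  unfolding closed_in_def by blast

lemma closed_in_closed: "closed_in X C \<Longrightarrow> Y \<subseteq> C \<Longrightarrow> closed_in C Y \<longleftrightarrow> closed_in X Y"
  unfolding closed_in_def by blast

lemma closed_in_Diff: "closed_in X C \<Longrightarrow> closed_in (X - T) (C - T)"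
  unfolding closed_in_def by blast

lemma comps_disjoint: "C \<in> comps X \<Longrightarrow> D \<in> comps X \<Longrightarrow> C \<noteq> D \<Longrightarrow> C \<inter> D = {}"
  using closed_in_Int[of X C D] compsD(2)[of C X] compsD(2)[of D X]
    compsD(4)[of C X "C \<inter> D"] compsD(4)[of D X "C \<inter> D"] by auto

lemma comps_subset_comps:
  assumes "closed_in X C"
  shows "comps C = {D \<in> comps X. D \<subseteq> C}"
proof -
  have eq: "closed_in C Y \<longleftrightarrow> closed_in X Y" if "Y \<subseteq> C" for Y
    by (rule closed_in_closed[OF assms that])
  have sub: "D \<subseteq> C" if "closed_in C D" for D using that by (simp add: closed_in_def)
  show ?thesis
  proof (intro set_eqI iffI)
    fix D assume D: "D \<in> comps C"
    note D' = compsD[OF D]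
    have "D \<in> comps X" using D' by (intro compsI) (auto simp: eq)
    then show "D \<in> {D \<in> comps X. D \<subseteq> C}" using D'(3) by simp
  next
    fix D assume "D \<in> {D \<in> comps X. D \<subseteq> C}"
    then have D: "D \<in> comps X" "D \<subseteq> C" by auto
    note D' = compsD[OF D(1)]
    show "D \<in> comps C"
    proof (rule compsI)
      show "closed_in C D" using D' D(2) by (simp add: eq)
      fix Y assume "Y \<subseteq> D" "closed_in C Y" "Y \<noteq> {}"
      then show "Y = D" using D'(4) D(2) eq sub by blast
    qed (rule D')
  qed
qed

text \<open>A component is an atom, so it cannot straddle a closed set.\<close>

lemma comps_split:
  assumes "closed_in X C"
  shows "comps X = comps C \<union> comps (X - C)"
proof -
  have "D \<subseteq> C \<or> D \<subseteq> X - C" if "D \<in> comps X" for D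
  proof -
    have "C \<inter> D = {} \<or> C \<inter> D = D"
      using compsD(4)[OF that, of "C \<inter> D"] closed_in_Int[OF assms compsD(2)[OF that]] by auto
    then show ?thesis using compsD(3)[OF that] by auto
  qed
  then show ?thesis
    unfolding comps_subset_comps[OF assms] comps_subset_comps[OF closed_in_compl[OF assms]] by auto
qed

lemma comps_comp:
  assumes C: "C \<in> comps X"
  shows "comps C = {C}"
proof -
  have "D = C" if "D \<in> comps X" "D \<subseteq> C" for D
    using compsD(4)[OF C that(2)] compsD(1,2)[OF that(1)] by simp
  then show ?thesis unfolding comps_subset_comps[OF compsD(2)[OF C]] using C by auto
qed

lemma ex_comp:
  assumes "x \<in> X"
  shows "\<exists>C\<in>comps X. x \<in> C"
proof
  let ?C = "\<Inter>{Y. closed_in X Y \<and> x \<in> Y}"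
  have X: "closed_in X X" unfolding closed_in_def by blast
  then have cl: "closed_in X ?C" using assms unfolding closed_in_def by blast
  show "x \<in> ?C" by blast
  show "?C \<in> comps X"
  proof (rule compsI[OF _ cl])
    show "?C \<noteq> {}" by blast
    fix Y assume Y: "Y \<subseteq> ?C" "closed_in X Y" "Y \<noteq> {}"
    show "Y = ?C"
    proof (cases "x \<in> Y")
      case False
      then have "?C \<subseteq> X - Y" using assms closed_in_compl[OF Y(2)] by blast
      then show ?thesis using Y by blast
    qed (use Y in blast)
  qed
qed

lemma Union_comps: "\<Union>(comps X) = X"
  using ex_comp compsD(3) by blast

lemma finite_comps: "finite X \<Longrightarrow> finite (comps X)"
  using Union_comps by (metis finite_UnionD)

lemma finite_odd_comps: "finite X \<Longrightarrow> finite (odd_comps X)"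
  unfolding odd_comps_def by (simp add: finite_comps)

lemma card_odd_comps_split:
  assumes "finite X" "closed_in X C"
  shows "card (odd_comps X) = card (odd_comps C) + card (odd_comps (X - C))"
proof -
  have "odd_comps X = odd_comps C \<union> odd_comps (X - C)"
    using comps_split[OF assms(2)] unfolding odd_comps_def by blast
  moreover have "odd_comps C \<inter> odd_comps (X - C) = {}"
    using compsD(1,3) unfolding odd_comps_def by blast
  moreover have "finite C" using assms finite_subset unfolding closed_in_def by blast
  ultimately show ?thesis using assms(1) by (simp add: card_Un_disjoint finite_odd_comps)
qed

lemma odd_comps_comp:
  "C \<in> comps X \<Longrightarrow> odd_comps C = (if odd (card C) \<and> C \<inter> K = {} then {C} else {})"
  unfolding odd_comps_def by (auto simp: comps_comp)

text \<open>Modulo 2, the size of a set is the number of its components of odd size.\<close>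

lemma parity_odd_comps:
  assumes "finite X" "X \<inter> K = {}"
  shows "even (card X + card (odd_comps X))"
  using assms
proof (induction "card X" arbitrary: X rule: less_induct)
  case less
  show ?case
  proof (cases "X = {}")
    case True
    then show ?thesis using finite_odd_comps Union_comps[of "{}"]
      by (auto simp: odd_comps_def comps_def closed_in_def)
  next
    case False
    then obtain C where C: "C \<in> comps X" using ex_comp by blast
    note C' = compsD[OF C]
    have finC: "finite C" using C' less.prems finite_subset by blast
    have "card X = card C + card (X - C)"
      using C'(3) less.prems(1) finC by (metis card_Diff_subset card_mono le_add_diff_inverse)
    moreover have "even (card (X - C) + card (odd_comps (X - C)))"
    proof (rule less.hyps)
      show "card (X - C) < card X" using C' less.prems by (intro psubset_card_mono) auto
    qed (use less.prems in auto)
    moreover have "even (card C + card (odd_comps C))"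
      using odd_comps_comp[OF C] C'(3) less.prems(2) by auto
    ultimately show ?thesis using card_odd_comps_split[OF less.prems(1) C'(2)] by presburger
  qed
qed

definition covers :: "'a set \<Rightarrow> 'a set set \<Rightarrow> bool" where
  "covers V M \<longleftrightarrow> (\<forall>e\<in>M. \<exists>u v. e = {u, v} \<and> u \<noteq> v \<and> adj u v) \<and>
     disjoint M \<and> \<Union>M \<subseteq> V \<and> V - K \<subseteq> \<Union>M"

lemma covers_mono:
  assumes "covers V M" "V \<subseteq> W" "W - K \<subseteq> V"
  shows "covers W M"
proof -
  have "\<Union>M \<subseteq> V" "V - K \<subseteq> \<Union>M" using assms(1) by (simp_all add: covers_def)
  then have "\<Union>M \<subseteq> W" "W - K \<subseteq> \<Union>M" using assms(2,3) by (metis order_trans, blast)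
  then show ?thesis using assms(1) by (simp add: covers_def)
qed

lemma covers_UN:
  assumes "\<And>i. i \<in> I \<Longrightarrow> covers (B i) (M i)"
    and "\<And>i j. i \<in> I \<Longrightarrow> j \<in> I \<Longrightarrow> i \<noteq> j \<Longrightarrow> B i \<inter> B j = {}"
  shows "covers (\<Union>i\<in>I. B i) (\<Union>i\<in>I. M i)"
proof -
  have "disjoint (\<Union>i\<in>I. M i)"
    unfolding disjoint_def
  proof clarify
    fix e f i j assume *: "i \<in> I" "j \<in> I" "e \<in> M i" "f \<in> M j" "e \<noteq> f"
    show "e \<inter> f = {}"
    proof (cases "i = j")
      case True
      then show ?thesis using assms(1)[of i] * unfolding covers_def disjoint_def by blast
    next
      case False
      have "e \<subseteq> B i" "f \<subseteq> B j" using assms(1) * unfolding covers_def by blast+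
      then show ?thesis using assms(2)[OF *(1,2) False] by blast
    qed
  qed
  moreover have "\<exists>u v. e = {u, v} \<and> u \<noteq> v \<and> adj u v" if "e \<in> (\<Union>i\<in>I. M i)" for e
    using that assms(1) unfolding covers_def by (metis UN_E)
  moreover have "\<Union>(M i) \<subseteq> B i" "B i - K \<subseteq> \<Union>(M i)" if "i \<in> I" for i
    using assms(1)[OF that] by (auto simp: covers_def)
  then have "(\<Union>i\<in>I. \<Union>(M i)) \<subseteq> (\<Union>i\<in>I. B i)" "(\<Union>i\<in>I. B i) - K \<subseteq> (\<Union>i\<in>I. \<Union>(M i))"
    by (meson UN_mono order_refl, fastforce)
  moreover have "\<Union>(\<Union>i\<in>I. M i) = (\<Union>i\<in>I. \<Union>(M i))" by auto
  ultimately show ?thesis unfolding covers_def by simp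
qed

text \<open>The condition is necessary because each odd component that avoids \<open>K\<close> must have a vertex
  matched into \<open>S\<close>. For sufficiency, Anderson's proof of Tutte's theorem is adapted. A largest set \<open>S\<close>
  that attains equality leaves no slack: deleting a nonempty part of a component of the
  rest always loses against the bound (the fact \<open>strict\<close>). Hence a component that avoids \<open>K\<close> is odd, and
  deletion of any vertex leaves a set that is matched completely by induction; a component that
  meets \<open>K\<close> is matched after deleting a vertex of \<open>K\<close>. Hall's theorem
  assigns to each odd component its own neighbour in \<open>S\<close>, and equality makes the assignment
  surjective.\<close>

theorem tutte_partial:
  assumes "finite V" and "\<And>S. S \<subseteq> V \<Longrightarrow> card (odd_comps (V - S)) \<le> card S"
  shows "\<exists>M. covers V M"
  using assms
proof (induction "card V" arbitrary: V rule: less_induct)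
  case less
  note fin = less.prems(1) and tutte = less.prems(2)
  define tight where "tight S \<longleftrightarrow> S \<subseteq> V \<and> card (odd_comps (V - S)) = card S" for S
  have "tight {}" using tutte[of "{}"] by (simp add: tight_def)
  moreover have "\<forall>S. tight S \<longrightarrow> card S < Suc (card V)"
    using fin by (auto simp: tight_def less_Suc_eq_le card_mono)
  ultimately obtain S where S: "tight S" and max: "\<And>T. tight T \<Longrightarrow> card T \<le> card S"
    using ex_has_greatest_nat[of tight "{}" card "Suc (card V)"] by blast
  define X where "X = V - S"
  have SV: "S \<subseteq> V" and cardS: "card (odd_comps X) = card S"
    using S by (auto simp: tight_def X_def)
  have finS: "finite S" and finX: "finite X" using SV fin by (auto simp: X_def intro: finite_subset)
  have strict: "card (odd_comps (C - T)) < card (odd_comps C) + card T"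
    if C: "C \<in> comps X" and T: "T \<subseteq> C" "T \<noteq> {}" for C T
  proof -
    note C' = compsD[OF C]
    have finT: "finite T" using T C' finX by (meson finite_subset)
    have card_ST: "card (S \<union> T) = card S + card T"
      using T C' finT finS by (intro card_Un_disjoint) (auto simp: X_def)
    have "card T > 0" using T finT by (simp add: card_gt_0_iff)
    then have "\<not> tight (S \<union> T)" using max[of "S \<union> T"] card_ST by auto
    moreover have "S \<union> T \<subseteq> V" using SV T C'(3) by (auto simp: X_def)
    ultimately have "card (odd_comps (V - (S \<union> T))) < card S + card T"
      using tutte[of "S \<union> T"] card_ST by (auto simp: tight_def)
    moreover have "V - (S \<union> T) = X - T" by (auto simp: X_def)
    moreover have "card (odd_comps (X - T)) = card (odd_comps (C - T)) + card (odd_comps (X - C))"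
    proof -
      have "X - T - (C - T) = X - C" using T by blast
      then show ?thesis
        using card_odd_comps_split[OF _ closed_in_Diff[OF C'(2), of T]] finX by simp
    qed
    ultimately show ?thesis using card_odd_comps_split[OF finX C'(2)] cardS by simp
  qed
  have small: "card (C - {x}) < card V" "finite C" if "C \<in> comps X" "x \<in> C" for C x
  proof -
    have "C \<subseteq> V" using compsD(3)[OF that(1)] by (auto simp: X_def)
    then have "C - {x} \<subset> V" using that(2) by auto
    then show "card (C - {x}) < card V" by (rule psubset_card_mono[OF fin])
    show "finite C" using \<open>C \<subseteq> V\<close> fin by (rule finite_subset)
  qed
  have odd_free: "odd (card C)" if C: "C \<in> comps X" and free: "C \<inter> K = {}" for C
  proof (rule ccontr)
    assume even: "\<not> odd (card C)"
    obtain x where x: "x \<in> C" using compsD(1)[OF C] by blast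
    have "card (odd_comps (C - {x})) < 1"
      using strict[OF C, of "{x}"] x even by (simp add: odd_comps_comp[OF C])
    moreover have "even (card (C - {x}) + card (odd_comps (C - {x})))"
      using free small(2)[OF C x] by (intro parity_odd_comps) auto
    moreover have "card C = Suc (card (C - {x}))"
      using x small(2)[OF C x] by (metis card_Suc_Diff1)
    ultimately show False using even by simp
  qed
  have critical: "\<exists>M. covers (C - {x}) M"
    if C: "C \<in> comps X" and free: "C \<inter> K = {}" and x: "x \<in> C" for C x
  proof (rule less.hyps)
    show "card (C - {x}) < card V" "finite (C - {x})" using small[OF C x] by auto
    fix T assume T: "T \<subseteq> C - {x}"
    have finT: "finite T" and finC: "finite C" using T small(2)[OF C x] by (auto intro: finite_subset)
    have eq: "C - insert x T = C - {x} - T" by blast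
    have sub: "insert x T \<subseteq> C" using T x by blast
    have "card (odd_comps (C - {x} - T)) < 1 + card (insert x T)"
      using strict[OF C sub] odd_free[OF C free] free
      by (simp add: odd_comps_comp[OF C] eq)
    then have "card (odd_comps (C - {x} - T)) \<le> card T + 1"
      using T finT by (subst (asm) card_insert_disjoint) auto
    moreover have "even (card (C - {x} - T) + card (odd_comps (C - {x} - T)))"
      using free finC by (intro parity_odd_comps) auto
    moreover have "card C = Suc (card (C - {x} - T) + card T)"
    proof -
      have "card (C - {x}) = card (C - {x} - T) + card T"
        using T finT finC by (metis card_Diff_subset card_mono finite_Diff le_add_diff_inverse2)
      then show ?thesis using x finC by (metis card_Suc_Diff1)
    qed
    \<comment> \<open>Parity turns the bound that is too weak by one into the required one.\<close>
    moreover have "q \<le> t" if "q \<le> t + 1" "even (r + q)" "n = Suc (r + t)" "odd n" for q r t n :: nat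
      using that by presburger
    ultimately show "card (odd_comps (C - {x} - T)) \<le> card T"
      using odd_free[OF C free] by blast
  qed
  have touching: "\<exists>M. covers C M" if C: "C \<in> comps X" and meets: "C \<inter> K \<noteq> {}" for C
  proof -
    obtain k where k: "k \<in> C" "k \<in> K" using meets by blast
    have "\<exists>M. covers (C - {k}) M"
    proof (rule less.hyps)
      show "card (C - {k}) < card V" "finite (C - {k})" using small[OF C k(1)] by auto
      fix T assume T: "T \<subseteq> C - {k}"
      have finT: "finite T" using T small(2)[OF C k(1)] by (auto intro: finite_subset)
      have eq: "C - insert k T = C - {k} - T" by blast
      have sub: "insert k T \<subseteq> C" using T k by blast
      have "card (odd_comps (C - {k} - T)) < card (insert k T)"
        using strict[OF C sub] meets by (simp add: odd_comps_comp[OF C] eq)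
      then show "card (odd_comps (C - {k} - T)) \<le> card T"
        using T finT by (subst (asm) card_insert_disjoint) auto
    qed
    then obtain M where "covers (C - {k}) M" by blast
    then have "covers C M" by (rule covers_mono) (use k in auto)
    then show ?thesis by blast
  qed
  define N where "N C = {s \<in> S. \<exists>x\<in>C. adj x s}" for C
  have "\<exists>r. inj_on r (odd_comps X) \<and> (\<forall>C\<in>odd_comps X. r C \<in> N C)"
  proof (rule hall_marriage)
    show "finite (odd_comps X)" using finX by (rule finite_odd_comps)
    show "finite (N C)" for C using finS by (simp add: N_def)
    fix \<D> assume \<D>: "\<D> \<subseteq> odd_comps X"
    let ?N = "\<Union>C\<in>\<D>. N C"
    have NS: "?N \<subseteq> S" by (auto simp: N_def)
    have "\<D> \<subseteq> odd_comps (V - ?N)"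
    proof
      fix C assume "C \<in> \<D>"
      then have C: "C \<in> comps X" "odd (card C)" "C \<inter> K = {}"
        using \<D> by (auto simp: odd_comps_def)
      note C' = compsD[OF C(1)]
      have XN: "X \<subseteq> V - ?N" using NS by (auto simp: X_def)
      have "w \<in> C" if "u \<in> C" "w \<in> V - ?N" "adj u w" for u w
      proof -
        have "w \<notin> S" using that \<open>C \<in> \<D>\<close> by (auto simp: N_def)
        then show ?thesis using C'(2) that by (auto simp: closed_in_def X_def)
      qed
      then have "closed_in (V - ?N) C"
        using order_trans[OF C'(3) XN] by (simp add: closed_in_def)
      moreover have "closed_in X Y" if "Y \<subseteq> C" "closed_in (V - ?N) Y" for Y
      proof -
        show ?thesis
          using that(2) order_trans[OF that(1) C'(3)] subsetD[OF XN] by (simp add: closed_in_def)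
      qed
      ultimately have "C \<in> comps (V - ?N)" using C' by (intro compsI) auto
      then show "C \<in> odd_comps (V - ?N)" using C by (simp add: odd_comps_def)
    qed
    then have "card \<D> \<le> card (odd_comps (V - ?N))"
      using fin by (intro card_mono finite_odd_comps) auto
    also have "\<dots> \<le> card ?N" using NS SV by (intro tutte) auto
    finally show "card \<D> \<le> card ?N" .
  qed
  then obtain r where r: "inj_on r (odd_comps X)" "\<forall>C\<in>odd_comps X. r C \<in> N C" by blast
  have rS: "r ` odd_comps X = S"
    using r cardS finS by (intro card_subset_eq) (auto simp: N_def card_image)
  define B where "B C = (if C \<in> odd_comps X then insert (r C) C else C)" for C
  have rB: "r C \<in> S" if "C \<in> odd_comps X" for C using that rS by blast
  have "\<exists>M. covers (B C) M" if C: "C \<in> comps X" for C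
  proof (cases "C \<inter> K = {}")
    case True
    then have odd: "C \<in> odd_comps X" using C odd_free by (simp add: odd_comps_def)
    then obtain x where x: "x \<in> C" "adj x (r C)" using r(2) by (auto simp: N_def)
    have new: "r C \<notin> C" using rB[OF odd] compsD(3)[OF C] by (auto simp: X_def)
    obtain M where M: "covers (C - {x}) M" using critical[OF C True x(1)] by blast
    then have sub: "\<Union>M \<subseteq> C - {x}" "C - {x} - K \<subseteq> \<Union>M" and dis: "disjoint M"
      and edge: "\<forall>e\<in>M. \<exists>u v. e = {u, v} \<and> u \<noteq> v \<and> adj u v"
      by (auto simp: covers_def)
    have "disjoint (insert {x, r C} M)"
    proof -
      have "{x, r C} \<inter> e = {}" if "e \<in> M" for e using sub(1) new that by auto
      then show ?thesis using dis by (simp add: pairwise_insert disjnt_def Int_commute)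
    qed
    moreover have "\<exists>u v. e = {u, v} \<and> u \<noteq> v \<and> adj u v" if "e \<in> insert {x, r C} M" for e
      using that edge x new by (cases "e = {x, r C}") auto
    moreover have "\<Union>(insert {x, r C} M) \<subseteq> insert (r C) C" using sub(1) x(1) by auto
    moreover have "insert (r C) C - K \<subseteq> \<Union>(insert {x, r C} M)" using sub(2) by auto
    ultimately have "covers (insert (r C) C) (insert {x, r C} M)" unfolding covers_def by blast
    then show ?thesis using odd by (auto simp: B_def)
  next
    case False
    then show ?thesis using touching[OF C] by (auto simp: B_def odd_comps_def)
  qed
  then obtain M where M: "\<And>C. C \<in> comps X \<Longrightarrow> covers (B C) (M C)" by metis
  have "B C \<inter> B D = {}" if "C \<in> comps X" "D \<in> comps X" "C \<noteq> D" for C D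
  proof -
    have "C \<inter> D = {}" "C \<subseteq> X" "D \<subseteq> X" using comps_disjoint compsD(3) that by auto
    then show ?thesis using rB inj_onD[OF r(1), of C D] that(3) by (auto simp: B_def X_def)
  qed
  then have "covers (\<Union>C\<in>comps X. B C) (\<Union>C\<in>comps X. M C)" by (intro covers_UN M)
  moreover have "(\<Union>C\<in>comps X. B C) = V"
  proof -
    have "(\<Union>C\<in>comps X. B C) = \<Union>(comps X) \<union> r ` odd_comps X"
      by (auto simp: B_def odd_comps_def split: if_splits)
    also have "\<dots> = X \<union> S" by (simp only: Union_comps rS)
    also have "\<dots> = V" using SV by (auto simp: X_def)
    finally show ?thesis .
  qed
  ultimately show ?case by auto
qed

text \<open>The condition of \<open>tutte_partial\<close> follows by double counting from a weight that
  lets every vertex \<open>s\<close> give away at most 1 in total and lets every odd component receive at least 1 from \<open>S\<close>.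
  The weight may be asymmetric: what \<open>s\<close> gives to \<open>c\<close> matters only when \<open>s\<close> lies in \<open>S\<close> and
  \<open>c\<close> in a component.\<close>

lemma tutte_partial_weighted:
  fixes w :: "'a \<Rightarrow> 'a \<Rightarrow> real"
  assumes fin: "finite V" and nonneg: "\<And>s c. w s c \<ge> 0"
    and capacity: "\<And>s. s \<in> V \<Longrightarrow> (\<Sum>c\<in>V. w s c) \<le> 1"
    and inflow: "\<And>S C. S \<subseteq> V \<Longrightarrow> C \<in> odd_comps (V - S) \<Longrightarrow> (\<Sum>c\<in>C. \<Sum>s\<in>S. w s c) \<ge> 1"
  shows "\<exists>M. covers V M"
proof (rule tutte_partial[OF fin])
  fix S assume S: "S \<subseteq> V"
  let ?O = "odd_comps (V - S)"
  have sub: "C \<subseteq> V - S" if "C \<in> ?O" for C using that compsD(3) by (simp add: odd_comps_def)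
  then have finC: "finite C" if "C \<in> ?O" for C
    using that fin by (meson finite_Diff finite_subset)
  have "real (card ?O) = (\<Sum>C\<in>?O. 1)" by simp
  also have "\<dots> \<le> (\<Sum>C\<in>?O. \<Sum>c\<in>C. \<Sum>s\<in>S. w s c)"
    using inflow[OF S] by (intro sum_mono) auto
  also have "\<dots> = (\<Sum>c\<in>\<Union>?O. \<Sum>s\<in>S. w s c)"
  proof (subst sum.Union_disjoint)
    show "\<forall>A\<in>?O. finite A" using finC by blast
    show "\<forall>A\<in>?O. \<forall>B\<in>?O. A \<noteq> B \<longrightarrow> A \<inter> B = {}"
      using comps_disjoint[of _ "V - S"] by (simp add: odd_comps_def)
  qed simp
  also have "\<dots> = (\<Sum>s\<in>S. \<Sum>c\<in>\<Union>?O. w s c)" by (rule sum.swap)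
  also have "\<dots> \<le> (\<Sum>s\<in>S. \<Sum>c\<in>V. w s c)"
    using sub fin nonneg by (intro sum_mono sum_mono2) auto
  also have "\<dots> \<le> (\<Sum>s\<in>S. 1)" using capacity S by (intro sum_mono) auto
  finally show "card ?O \<le> card S" by simp
qed

end

section \<open>Half-edges and parity of cuts\<close>

text \<open>The vertices of the matching problem below: one for each half-edge, and numbered core vertices
  for each vertex of the graph.\<close>

datatype ('v, 'h) node = Half 'h | Core 'v nat

text \<open>An edge is a pair \<open>{x, flip x}\<close>, and \<open>base x\<close> is the vertex to which the half-edge \<open>x\<close> is attached.
  Loops and parallel edges need no special treatment, and a loop counts twice in the degree.\<close>

locale half_edge_graph =
  fixes V :: "'v set" and H :: "'h set" and base :: "'h \<Rightarrow> 'v" and flip :: "'h \<Rightarrow> 'h"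
  assumes finite_V: "finite V" and finite_H: "finite H"
    and base_in: "x \<in> H \<Longrightarrow> base x \<in> V"
    and flip_in: "x \<in> H \<Longrightarrow> flip x \<in> H"
    and flip_neq: "x \<in> H \<Longrightarrow> flip x \<noteq> x"
    and flip_flip: "x \<in> H \<Longrightarrow> flip (flip x) = x"
begin

definition halves :: "'v \<Rightarrow> 'h set" where "halves v = {x \<in> H. base x = v}"

definition leaving :: "'v set \<Rightarrow> 'h set" where
  "leaving U = {x \<in> H. base x \<in> U \<and> base (flip x) \<notin> U}"

lemma finite_halves [simp]: "finite (halves v)"
  using finite_H by (simp add: halves_def)

lemma even_card_flip_closed:
  assumes "Y \<subseteq> H" "\<And>x. x \<in> Y \<Longrightarrow> flip x \<in> Y"
  shows "even (card Y)"
proof -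
  have "finite Y" using assms(1) finite_H by (rule finite_subset)
  then show ?thesis using assms
  proof (induction "card Y" arbitrary: Y rule: less_induct)
    case less
    show ?case
    proof (cases "Y = {}")
      case False
      then obtain x where x: "x \<in> Y" by blast
      have xH: "x \<in> H" using x less.prems by blast
      let ?P = "{x, flip x}"
      have P: "?P \<subseteq> Y" "card ?P = 2" using x less.prems(3) flip_neq[OF xH] by auto
      have "even (card (Y - ?P))"
      proof (rule less.hyps)
        show "card (Y - ?P) < card Y" using x less.prems(1) by (intro psubset_card_mono) auto
        show "flip z \<in> Y - ?P" if "z \<in> Y - ?P" for z
          using that less.prems flip_flip xH by (metis Diff_iff insert_iff empty_iff subsetD)
      qed (use less.prems in auto)
      moreover have "card Y = card (Y - ?P) + 2"
        using P less.prems(1) by (metis card_Diff_subset card_mono finite_subset le_add_diff_inverse2)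
      ultimately show ?thesis by simp
    qed simp
  qed
qed

lemma parity_leaving:
  assumes "U \<subseteq> V"
  shows "even ((\<Sum>v\<in>U. card (halves v)) + card (leaving U))"
proof -
  let ?B = "{x \<in> H. base x \<in> U \<and> base (flip x) \<in> U}"
  have "(\<Sum>v\<in>U. card (halves v)) = card (\<Union>v\<in>U. halves v)"
    using finite_subset[OF assms finite_V]
    by (intro card_UN_disjoint[symmetric]) (auto simp: halves_def finite_H)
  also have "(\<Union>v\<in>U. halves v) = ?B \<union> leaving U" by (auto simp: halves_def leaving_def)
  also have "card \<dots> = card ?B + card (leaving U)"
    using finite_H by (intro card_Un_disjoint) (auto simp: leaving_def)
  finally show ?thesis
    using even_card_flip_closed[of ?B] flip_in flip_flip by auto
qed

end

section \<open>Degree-constrained splitting as a matching problem\<close>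

text \<open>Sought is a set \<open>F\<close> of edges such that at every \<open>v\<close> at least \<open>a\<close> half-edges lie in \<open>F\<close> and at
  least \<open>b\<close> lie outside. A vertex \<open>v\<close> is replaced by its half-edges and \<open>deg v - a\<close> core vertices,
  with all edges between the two kinds. A half-edge matched with its flip is put into \<open>F\<close>, one
  matched with a core is not. Covering all half-edges leaves at most
  \<open>deg v - a\<close> of them outside \<open>F\<close>; covering the first \<open>b\<close> cores leaves at least \<open>b\<close> outside. The
  remaining cores are optional, and exist exactly when \<open>deg v > a + b\<close>.\<close>

locale split_gadget = half_edge_graph +
  fixes a b :: nat
  assumes a_pos: "a > 0" and b_pos: "b > 0"
    and deg_ge: "v \<in> V \<Longrightarrow> a + b \<le> card (halves v)"
begin

abbreviation deg :: "'a \<Rightarrow> nat" where "deg v \<equiv> card (halves v)"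

definition nodes :: "('a, 'b) node set" where
  "nodes = Half ` H \<union> (\<Union>v\<in>V. Core v ` {..<deg v - a})"

definition optional :: "('a, 'b) node set" where
  "optional = {Core v j | v j. b \<le> j}"

fun adj :: "('a, 'b) node \<Rightarrow> ('a, 'b) node \<Rightarrow> bool" where
  "adj (Half x) (Half y) \<longleftrightarrow> x \<in> H \<and> y \<in> H \<and> y = flip x"
| "adj (Half x) (Core v j) \<longleftrightarrow> base x = v"
| "adj (Core v j) (Half x) \<longleftrightarrow> base x = v"
| "adj (Core v j) (Core u i) \<longleftrightarrow> False"

text \<open>This starts from the fractional solution that puts the fraction \<open>a / (a + b)\<close> of every edge into \<open>F\<close>.
  A core spreads its unit evenly over the half-edges at its vertex. The weight is asymmetric at optional cores, which give
  to half-edges but receive nothing: components with an optional core need no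
  inflow, and if a half-edge also gave to optional cores, its total would exceed 1.\<close>

fun weight :: "('a, 'b) node \<Rightarrow> ('a, 'b) node \<Rightarrow> real" where
  "weight (Half x) (Half y) = (if y = flip x then a / (a + b) else 0)"
| "weight (Half x) (Core v j) = (if base x = v \<and> j < b then 1 / deg v else 0)"
| "weight (Core v j) (Half x) = (if base x = v then 1 / deg v else 0)"
| "weight (Core v j) (Core u i) = 0"

sublocale G: partly_covered_graph adj optional
proof
  show "adj v u" if "adj u v" for u v
    using that by (cases u; cases v) (auto simp: flip_flip)
qed

lemma Half_in_nodes [simp]: "Half x \<in> nodes \<longleftrightarrow> x \<in> H"
  by (auto simp: nodes_def)

lemma Core_in_nodes [simp]: "Core v j \<in> nodes \<longleftrightarrow> v \<in> V \<and> j < deg v - a"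
  by (auto simp: nodes_def)

lemma Core_in_optional [simp]: "Core v j \<in> optional \<longleftrightarrow> b \<le> j"
  by (auto simp: optional_def)

lemma Half_notin_optional [simp]: "Half x \<notin> optional"
  by (auto simp: optional_def)

lemma finite_nodes: "finite nodes"
  using finite_H finite_V by (auto simp: nodes_def)

lemma weight_nonneg: "weight s c \<ge> 0"
  by (cases s; cases c) auto

lemma halves_nonempty: "v \<in> V \<Longrightarrow> halves v \<noteq> {}"
  using deg_ge[of v] a_pos by auto

lemma fraction_sum: "real a / (a + b) + real b / (a + b) = 1"
  using a_pos by (simp add: add_divide_distrib[symmetric])

lemma fraction_b_le:
  assumes "v \<in> V"
  shows "real b / deg v \<le> real b / (a + b)"
  using deg_ge[OF assms] a_pos by (intro divide_left_mono) (auto simp flip: of_nat_add)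

lemma fraction_b_ge:
  assumes "v \<in> V"
  shows "real b / (a + b) \<le> real (deg v - a) / deg v"
proof -
  have "real (deg v - a) / deg v = 1 - real a / deg v"
    using deg_ge[OF assms] halves_nonempty[OF assms] by (simp add: of_nat_diff field_simps)
  moreover have "real a / deg v \<le> real a / (a + b)"
    using deg_ge[OF assms] a_pos by (intro divide_left_mono) (auto simp flip: of_nat_add)
  ultimately show ?thesis using fraction_sum by linarith
qed

lemma capacity:
  assumes "s \<in> nodes"
  shows "(\<Sum>c\<in>nodes. weight s c) \<le> 1"
proof (cases s)
  case (Half x)
  then have x: "x \<in> H" using assms by simp
  let ?T = "insert (Half (flip x)) (Core (base x) ` {..<b})"
  have "weight s c = 0" if "c \<notin> ?T" for c using that Half by (cases c) auto
  then have "(\<Sum>c\<in>nodes. weight s c) \<le> (\<Sum>c\<in>nodes \<inter> ?T. weight s c)"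
    using finite_nodes by (subst sum.inter_restrict) (auto intro!: sum_mono)
  also have "\<dots> \<le> (\<Sum>c\<in>?T. weight s c)" by (intro sum_mono2) (auto simp: weight_nonneg)
  also have "\<dots> = a / (a + b) + (\<Sum>j<b. weight s (Core (base x) j))"
    using Half by (subst sum.insert) (auto simp: sum.reindex inj_on_def)
  also have "\<dots> = a / (a + b) + b / deg (base x)" using Half by simp
  also have "\<dots> \<le> 1" using fraction_b_le[OF base_in[OF x]] fraction_sum by linarith
  finally show ?thesis .
next
  case (Core v j)
  then have v: "v \<in> V" using assms by simp
  let ?T = "Half ` halves v"
  have "weight s c = 0" if "c \<in> nodes" "c \<notin> ?T" for c
    using that Core by (cases c) (auto simp: halves_def)
  then have "(\<Sum>c\<in>nodes. weight s c) \<le> (\<Sum>c\<in>nodes \<inter> ?T. weight s c)"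
    using finite_nodes by (subst sum.inter_restrict) (auto intro!: sum_mono)
  also have "\<dots> \<le> (\<Sum>c\<in>?T. weight s c)" by (intro sum_mono2) (auto simp: weight_nonneg)
  also have "\<dots> = (\<Sum>x\<in>halves v. 1 / deg v)"
    using Core by (subst sum.reindex) (auto simp: inj_on_def halves_def)
  also have "\<dots> = 1" using halves_nonempty[OF v] by simp
  finally show ?thesis by simp
qed

text \<open>A barrier \<open>S\<close> and an odd component \<open>C\<close> without optional cores are fixed for the
  discharging: the aim is that \<open>C\<close> receives total weight at least 1 from \<open>S\<close>.\<close>

context
  fixes S C
  assumes S: "S \<subseteq> nodes" and C: "C \<in> G.odd_comps (nodes - S)"
begin

definition cores :: "'a \<Rightarrow> nat" where "cores v = card {j. Core v j \<in> C}"

text \<open>The part of the inflow into \<open>C\<close> that involves the half-edge \<open>x\<close>: what \<open>x\<close> receives if it belongs to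
  \<open>C\<close>, and what it gives to the cores in \<open>C\<close> if it belongs to \<open>S\<close>. A half-edge in \<open>C\<close> is adjacent to all cores of its base,
  so those outside \<open>C\<close> lie in \<open>S\<close> and contribute.\<close>

definition charge :: "'b \<Rightarrow> real" where
  "charge x =
    (if Half x \<in> C then
       (if Half (flip x) \<in> S then a / (a + b) else 0)
         + real (deg (base x) - a - cores (base x)) / deg (base x)
     else if Half x \<in> S then real (cores (base x)) / deg (base x)
     else 0)"

lemma C_comp: "C \<in> G.comps (nodes - S)" and odd_C: "odd (card C)" and C_free: "C \<inter> optional = {}"
  using C by (auto simp: G.odd_comps_def)

lemma C_sub: "C \<subseteq> nodes" "C \<inter> S = {}"
  using G.compsD(3)[OF C_comp] by auto

lemma finite_C: "finite C"
  using C_sub finite_nodes finite_subset by blast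

lemma finite_S: "finite S"
  using S finite_nodes finite_subset by blast

lemma C_closed: "u \<in> C \<Longrightarrow> adj u w \<Longrightarrow> w \<in> nodes \<Longrightarrow> w \<in> C \<or> w \<in> S"
  using G.compsD(2)[OF C_comp] unfolding G.closed_in_def by blast

lemma C_connected: "Y \<subseteq> C \<Longrightarrow> Y \<noteq> {} \<Longrightarrow> (\<And>u w. u \<in> Y \<Longrightarrow> w \<in> C \<Longrightarrow> adj u w \<Longrightarrow> w \<in> Y) \<Longrightarrow> Y = C"
proof -
  assume Y: "Y \<subseteq> C" "Y \<noteq> {}" and cl: "\<And>u w. u \<in> Y \<Longrightarrow> w \<in> C \<Longrightarrow> adj u w \<Longrightarrow> w \<in> Y"
  have "w \<in> Y" if "u \<in> Y" "w \<in> nodes - S" "adj u w" for u w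
    using C_closed[of u w] cl[of u w] that Y(1) by auto
  then have "G.closed_in (nodes - S) Y"
    using Y(1) G.compsD(3)[OF C_comp] by (auto simp: G.closed_in_def)
  then show "Y = C" using G.compsD(4)[OF C_comp Y(1)] Y(2) by simp
qed

lemma cores_sub: "{j. Core v j \<in> C} \<subseteq> {..<min b (deg v - a)}"
  using C_sub C_free by (fastforce simp: not_le[symmetric])

lemma cores_le: "cores v \<le> b" "cores v \<le> deg v - a"
  using card_mono[OF _ cores_sub, of v] by (auto simp: cores_def)

lemma finite_cores: "finite {j. Core v j \<in> C}"
  using cores_sub by (rule finite_subset) simp

lemma cores_pos_iff: "cores v > 0 \<longleftrightarrow> (\<exists>j. Core v j \<in> C)"
  using finite_cores by (auto simp: cores_def card_gt_0_iff)

lemma charge_nonneg: "charge x \<ge> 0"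
  by (simp add: charge_def)

lemma flip_cases: "x \<in> H \<Longrightarrow> Half x \<in> C \<Longrightarrow> Half (flip x) \<in> C \<or> Half (flip x) \<in> S"
  using C_closed[of "Half x" "Half (flip x)"] flip_in by simp

text \<open>Every pair of positive weight contains a half-edge, and a pair of two half-edges is attributed to the
  receiving one, so nothing is counted twice.\<close>

lemma inflow_ge_charges: "(\<Sum>x\<in>H. charge x) \<le> (\<Sum>c\<in>C. \<Sum>s\<in>S. weight s c)"
proof -
  define CC where "CC = {c \<in> C. \<exists>v j. c = Core v j}"
  define CH where "CH = {x \<in> H. Half x \<in> C}"
  define SH where "SH = {x \<in> H. Half x \<in> S}"
  have fin: "finite CC" "finite CH" "finite SH"
    using finite_C finite_H by (auto simp: CC_def CH_def SH_def)
  have C_eq: "C = Half ` CH \<union> CC" using C_sub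
    by (auto simp: CC_def CH_def image_iff) (metis node.exhaust Half_in_nodes subsetD)
  have dis: "Half ` CH \<inter> CC = {}" by (auto simp: CC_def)
  have to_half: "(\<Sum>s\<in>S. weight s (Half x)) \<ge> charge x" if x: "x \<in> CH" for x
  proof -
    have xH: "x \<in> H" "Half x \<in> C" using x by (auto simp: CH_def)
    let ?v = "base x"
    let ?J = "{..<deg ?v - a} - {j. Core ?v j \<in> C}"
    let ?T = "(S \<inter> {Half (flip x)}) \<union> Core ?v ` ?J"
    have "Core ?v j \<in> S" if "j \<in> ?J" for j
      using C_closed[OF xH(2), of "Core ?v j"] that base_in[OF xH(1)] by auto
    then have TS: "?T \<subseteq> S" by auto
    have "card ?J = deg ?v - a - cores ?v"
      using cores_sub[of ?v] finite_cores by (subst card_Diff_subset) (auto simp: cores_def)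
    then have "charge x = (\<Sum>s\<in>(S \<inter> {Half (flip x)}). weight s (Half x))
        + (\<Sum>s\<in>Core ?v ` ?J. weight s (Half x))"
      using xH flip_flip
      by (cases "Half (flip x) \<in> S") (auto simp: charge_def sum.reindex inj_on_def)
    also have "\<dots> = (\<Sum>s\<in>?T. weight s (Half x))"
      by (rule sum.union_disjoint[symmetric]) auto
    also have "\<dots> \<le> (\<Sum>s\<in>S. weight s (Half x))"
      using TS finite_S by (intro sum_mono2) (auto simp: weight_nonneg)
    finally show ?thesis .
  qed
  have from_half: "(\<Sum>c\<in>CC. weight (Half x) c) \<ge> charge x" if x: "x \<in> SH" for x
  proof -
    have xH: "x \<in> H" "Half x \<in> S" "Half x \<notin> C" using x C_sub by (auto simp: SH_def)
    let ?J = "{j. Core (base x) j \<in> C}"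
    have "charge x = (\<Sum>j\<in>?J. 1 / deg (base x))" using xH by (simp add: charge_def cores_def)
    also have "\<dots> = (\<Sum>j\<in>?J. weight (Half x) (Core (base x) j))"
      using cores_sub[of "base x"] by (intro sum.cong) auto
    also have "\<dots> = (\<Sum>c\<in>Core (base x) ` ?J. weight (Half x) c)"
      by (subst sum.reindex) (auto simp: inj_on_def)
    also have "\<dots> \<le> (\<Sum>c\<in>CC. weight (Half x) c)"
      using fin by (intro sum_mono2) (auto simp: weight_nonneg CC_def)
    finally show ?thesis .
  qed
  have "(\<Sum>x\<in>H. charge x) = (\<Sum>x\<in>CH \<union> SH. charge x)"
    using finite_H by (intro sum.mono_neutral_right) (auto simp: CH_def SH_def charge_def)
  also have "\<dots> = (\<Sum>x\<in>CH. charge x) + (\<Sum>x\<in>SH. charge x)"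
    using C_sub fin by (intro sum.union_disjoint) (auto simp: CH_def SH_def)
  also have "\<dots> \<le> (\<Sum>x\<in>CH. \<Sum>s\<in>S. weight s (Half x)) + (\<Sum>x\<in>SH. \<Sum>c\<in>CC. weight (Half x) c)"
    using to_half from_half by (intro add_mono sum_mono)
  also have "(\<Sum>x\<in>CH. \<Sum>s\<in>S. weight s (Half x)) = (\<Sum>c\<in>Half ` CH. \<Sum>s\<in>S. weight s c)"
    by (simp add: sum.reindex inj_on_def)
  also have "(\<Sum>x\<in>SH. \<Sum>c\<in>CC. weight (Half x) c) = (\<Sum>s\<in>Half ` SH. \<Sum>c\<in>CC. weight s c)"
    by (simp add: sum.reindex inj_on_def)
  also have "\<dots> \<le> (\<Sum>s\<in>S. \<Sum>c\<in>CC. weight s c)"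
    using finite_S by (intro sum_mono2) (auto simp: SH_def weight_nonneg intro!: sum_nonneg)
  also have "\<dots> = (\<Sum>c\<in>CC. \<Sum>s\<in>S. weight s c)" by (rule sum.swap)
  also have "(\<Sum>c\<in>Half ` CH. \<Sum>s\<in>S. weight s c) + (\<Sum>c\<in>CC. \<Sum>s\<in>S. weight s c)
      = (\<Sum>c\<in>C. \<Sum>s\<in>S. weight s c)"
    unfolding C_eq using fin by (intro sum.union_disjoint[symmetric] dis) auto
  finally show ?thesis by simp
qed

lemma charges_subset: "Y \<subseteq> H \<Longrightarrow> (\<Sum>x\<in>Y. charge x) \<le> (\<Sum>x\<in>H. charge x)"
  using finite_H by (intro sum_mono2) (auto simp: charge_nonneg)

text \<open>At such a vertex each of the \<open>deg v\<close> half-edges has charge at least \<open>1 / deg v\<close>: a half-edge in \<open>C\<close> receives from a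
  missing core, and a half-edge in \<open>S\<close> gives to a core in \<open>C\<close>.\<close>

lemma charges_partial_vertex:
  assumes v: "cores v > 0" and part: "cores v < deg v - a \<or> (\<forall>x\<in>halves v. Half x \<notin> C)"
  shows "1 \<le> (\<Sum>x\<in>H. charge x)"
proof -
  obtain j where j: "Core v j \<in> C" using v cores_pos_iff by blast
  then have vV: "v \<in> V" using C_sub by auto
  have "1 / deg v \<le> charge x" if x: "x \<in> halves v" for x
  proof -
    have xH: "x \<in> H" "base x = v" using x by (auto simp: halves_def)
    show ?thesis
    proof (cases "Half x \<in> C")
      case True
      then have "1 \<le> real (deg v - a - cores v)" using part x by auto
      then have "1 / deg v \<le> real (deg v - a - cores v) / deg v" by (intro divide_right_mono) auto
      also have "\<dots> \<le> charge x" using True xH by (simp add: charge_def)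
      finally show ?thesis .
    next
      case False
      then have "Half x \<in> S" using C_closed[OF j, of "Half x"] xH by simp
      then show ?thesis using False xH v by (simp add: charge_def divide_right_mono)
    qed
  qed
  then have "(\<Sum>x\<in>halves v. 1 / deg v) \<le> (\<Sum>x\<in>halves v. charge x)" by (rule sum_mono)
  then have "1 \<le> (\<Sum>x\<in>halves v. charge x)" using halves_nonempty[OF vV] by simp
  also have "\<dots> \<le> (\<Sum>x\<in>H. charge x)" by (rule charges_subset) (auto simp: halves_def)
  finally show ?thesis .
qed

text \<open>A component without cores is a single half-edge or an edge; being odd, it is a single
  half-edge, and then all its neighbours lie in \<open>S\<close>.\<close>

lemma charges_no_core:
  assumes none: "\<And>v. cores v = 0"
  shows "1 \<le> (\<Sum>x\<in>H. charge x)"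
proof -
  have no_core: "Core v j \<notin> C" for v j using none[of v] cores_pos_iff[of v] by auto
  obtain c where c: "c \<in> C" using G.compsD(1)[OF C_comp] by blast
  then obtain x where x: "Half x \<in> C" using no_core by (cases c) auto
  then have xH: "x \<in> H" using C_sub by auto
  have "Half (flip x) \<notin> C"
  proof
    assume fx: "Half (flip x) \<in> C"
    have "{Half x, Half (flip x)} = C"
    proof (rule C_connected)
      fix u w assume "u \<in> {Half x, Half (flip x)}" "w \<in> C" "adj u w"
      then show "w \<in> {Half x, Half (flip x)}"
        using no_core xH by (cases w) (auto simp: flip_flip)
    qed (use x fx in auto)
    moreover have "card {Half x, Half (flip x)} = 2" using flip_neq[OF xH] by (simp add: eq_commute)
    ultimately have "card C = 2" by metis
    then show False using odd_C by simp
  qed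
  then have "Half (flip x) \<in> S" using flip_cases[OF xH x] by simp
  then have "charge x = real a / (a + b) + real (deg (base x) - a) / deg (base x)"
    using x none by (simp add: charge_def)
  then have "1 \<le> charge x" using fraction_b_ge[OF base_in[OF xH]] fraction_sum by linarith
  also have "charge x = (\<Sum>x\<in>{x}. charge x)" by simp
  also have "\<dots> \<le> (\<Sum>x\<in>H. charge x)" using xH by (intro charges_subset) auto
  finally show ?thesis .
qed

text \<open>The critical case. Every vertex with a core in \<open>C\<close> has all its cores there, none of them
  optional, so the set \<open>U\<close> of these vertices consists of vertices of degree \<open>a + b\<close>.
  Each edge leaving \<open>U\<close> contributes at least \<open>a / (a + b)\<close> if only its half at \<open>U\<close> is in \<open>C\<close> (the set \<open>Q1\<close>),
  and at least \<open>b / (a + b)\<close> otherwise. All edges outside \<open>Q1\<close> have both or no halves in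
  \<open>C\<close>, unless an edge within \<open>U\<close> already contributes 1, so the size of \<open>C\<close> has the parity of
  \<open>b * card U + card Q1\<close>. The hypothesis on cuts says that under this parity the contributions
  add up to at least 1.\<close>

lemma charges_full_vertices:
  assumes full: "\<And>v. cores v > 0 \<Longrightarrow> cores v = deg v - a"
    and some: "cores v0 > 0"
    and cut_bound: "\<And>U n1 n2. U \<subseteq> {v \<in> V. deg v = a + b} \<Longrightarrow> U \<noteq> {} \<Longrightarrow>
      n1 + n2 = card (leaving U) \<Longrightarrow> odd (b * card U + n1) \<Longrightarrow> a + b \<le> a * n1 + b * n2"
  shows "1 \<le> (\<Sum>x\<in>H. charge x)"
proof -
  define U where "U = {v. cores v > 0}"
  have UV: "v \<in> V" if "v \<in> U" for v
    using that C_sub by (auto simp: U_def cores_pos_iff)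
  have degU: "deg v = a + b" and coresU: "cores v = b" if "v \<in> U" for v
    using full[of v] cores_le(1)[of v] deg_ge[OF UV[OF that]] that by (auto simp: U_def)
  have finU: "finite U" using UV finite_V by (meson finite_subset subsetI)
  have core_iff: "Core v j \<in> C \<longleftrightarrow> v \<in> U \<and> j < b" for v j
  proof -
    have "{j. Core v j \<in> C} = {..<b}" if "v \<in> U"
      using cores_sub[of v] coresU[OF that] by (intro card_subset_eq) (auto simp: cores_def)
    then show ?thesis by (auto simp: U_def cores_pos_iff)
  qed
  \<comment> \<open>Otherwise the half-edge would be a component by itself, but \<open>C\<close> contains a core.\<close>
  have outer: "Half (flip x) \<in> C" if "x \<in> H" "Half x \<in> C" "base x \<notin> U" for x
  proof (rule ccontr)
    assume no: "Half (flip x) \<notin> C"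
    have "{Half x} = C"
    proof (rule C_connected)
      fix u w assume "u \<in> {Half x}" "w \<in> C" "adj u w"
      then show "w \<in> {Half x}" using no that core_iff by (cases w) auto
    qed (use that in auto)
    then show False using some core_iff cores_pos_iff by blast
  qed
  have out_charge: "b / (a + b) \<le> charge x" if "x \<in> H" "Half x \<in> C" "base x \<notin> U" for x
    using fraction_b_ge[OF base_in[OF that(1)]] that
    by (auto simp: charge_def U_def intro: add_increasing)
  have in_charge: "charge x = b / (a + b)" if "x \<in> H" "Half x \<in> S" "base x \<in> U" for x
    using that coresU degU C_sub by (auto simp: charge_def)
  have mid_charge: "a / (a + b) \<le> charge x" if "x \<in> H" "Half x \<in> C" "Half (flip x) \<notin> C" for x
    using flip_cases[OF that(1,2)] that by (simp add: charge_def)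
  have cover: "Half x \<in> C \<or> Half x \<in> S" if "x \<in> H" "base x \<in> U" for x
    using C_closed[of "Core (base x) 0" "Half x"] that core_iff b_pos by simp
  show ?thesis
  proof (cases "\<exists>x\<in>H. base x \<in> U \<and> base (flip x) \<in> U \<and> Half x \<in> C \<and> Half (flip x) \<notin> C")
    case True
    then obtain x where x: "x \<in> H" "base x \<in> U" "base (flip x) \<in> U" "Half x \<in> C" "Half (flip x) \<notin> C"
      by blast
    have "1 \<le> charge x + charge (flip x)"
      using mid_charge[of x] in_charge[of "flip x"] flip_cases[of x] x flip_in fraction_sum by simp
    also have "\<dots> = (\<Sum>x\<in>{x, flip x}. charge x)" using flip_neq[OF x(1)] by simp
    also have "\<dots> \<le> (\<Sum>x\<in>H. charge x)" using x(1) flip_in by (intro charges_subset) auto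
    finally show ?thesis .
  next
    case False
    define Q where "Q = leaving U"
    define Q1 where "Q1 = {x \<in> Q. Half x \<in> C \<and> Half (flip x) \<notin> C}"
    have QH: "x \<in> H" "base x \<in> U" "base (flip x) \<notin> U" if "x \<in> Q" for x
      using that by (auto simp: Q_def leaving_def)
    have finQ: "finite Q" using finite_H QH(1) by (meson finite_subset subsetI)
    have Q1Q: "Q1 \<subseteq> Q" by (auto simp: Q1_def)
    have "card Q1 + card (Q - Q1) = card Q"
      using finQ Q1Q by (metis card_Diff_subset card_mono finite_subset le_add_diff_inverse)
    moreover have "odd (b * card U + card Q1)"
    proof -
      define CH where "CH = {x \<in> H. Half x \<in> C}"
      define B where "B = {x \<in> H. Half x \<in> C \<and> Half (flip x) \<in> C}"
      define R :: "('a, 'b) node set" where "R = (\<lambda>(v, j). Core v j) ` (U \<times> {..<b})"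
      define P :: "('a, 'b) node set" where "P = Half ` CH"
      have "c \<in> C \<longleftrightarrow> c \<in> P \<union> R" for c
        using C_sub core_iff by (cases c) (auto simp: CH_def P_def R_def)
      then have "C = P \<union> R" by blast
      moreover have "finite P" "finite R" "P \<inter> R = {}"
        using finite_H finU by (auto simp: CH_def P_def R_def)
      ultimately have "card C = card P + card R" using card_Un_disjoint by metis
      also have "card P = card CH"
        unfolding P_def by (intro card_image) (auto simp: inj_on_def)
      also have "card R = card (U \<times> {..<b})"
        unfolding R_def by (intro card_image) (auto simp: inj_on_def)
      also have "CH = B \<union> Q1"
        using outer False by (auto simp: CH_def B_def Q1_def Q_def leaving_def)
      also have "card (B \<union> Q1) = card B + card Q1"
        using finite_H finQ by (intro card_Un_disjoint) (auto simp: B_def Q1_def)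
      finally have "card C = card B + card Q1 + b * card U" by (simp add: card_cartesian_product)
      moreover have "even (card B)"
        using flip_in flip_flip by (intro even_card_flip_closed) (auto simp: B_def)
      ultimately show ?thesis using odd_C by simp
    qed
    ultimately have "a + b \<le> a * card Q1 + b * card (Q - Q1)"
      using some UV degU by (intro cut_bound[of U]) (auto simp: Q_def U_def)
    then have "real (a + b) \<le> real (a * card Q1 + b * card (Q - Q1))" by (rule of_nat_mono)
    then have "1 \<le> (real a * card Q1 + real b * card (Q - Q1)) / (a + b)"
      using a_pos by (subst le_divide_eq_1_pos) auto
    also have "\<dots> = card Q1 * (a / (a + b)) + card (Q - Q1) * (b / (a + b))"
      by (simp add: add_divide_distrib mult.commute)
    finally have "1 \<le> card Q1 * (a / (a + b)) + card (Q - Q1) * (b / (a + b))" .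
    also have "\<dots> = (\<Sum>x\<in>Q1. a / (a + b)) + (\<Sum>x\<in>Q - Q1. b / (a + b))" by simp
    also have "\<dots> \<le> (\<Sum>x\<in>Q1. charge x + charge (flip x)) + (\<Sum>x\<in>Q - Q1. charge x + charge (flip x))"
    proof (intro add_mono sum_mono)
      fix x assume x: "x \<in> Q1"
      then have "a / (a + b) \<le> charge x" using QH by (intro mid_charge) (auto simp: Q1_def)
      then show "a / (a + b) \<le> charge x + charge (flip x)" using charge_nonneg[of "flip x"] by linarith
    next
      fix x assume x: "x \<in> Q - Q1"
      then have xQ: "x \<in> Q" by simp
      show "b / (a + b) \<le> charge x + charge (flip x)"
      proof (cases "Half x \<in> S")
        case True
        then show ?thesis using in_charge[OF QH(1)[OF xQ] True QH(2)[OF xQ]] charge_nonneg[of "flip x"]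
          by linarith
      next
        case no: False
        then have "Half (flip x) \<in> C" using x cover[OF QH(1)[OF xQ] QH(2)[OF xQ]] by (auto simp: Q1_def)
        then show ?thesis
          using out_charge[of "flip x"] QH[OF xQ] flip_in charge_nonneg[of x] by fastforce
      qed
    qed
    also have "\<dots> = (\<Sum>x\<in>Q. charge x + charge (flip x))"
      using finQ Q1Q by (simp add: sum.subset_diff[of Q1 Q])
    also have "\<dots> = (\<Sum>x\<in>Q. charge x) + (\<Sum>x\<in>flip ` Q. charge x)"
      using flip_flip QH(1) by (subst sum.reindex) (auto simp: sum.distrib inj_on_def, metis)
    also have "\<dots> = (\<Sum>x\<in>Q \<union> flip ` Q. charge x)"
      using finQ QH by (intro sum.union_disjoint[symmetric]) auto
    also have "\<dots> \<le> (\<Sum>x\<in>H. charge x)" using QH flip_in by (intro charges_subset) auto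
    finally show ?thesis .
  qed
qed

end

text \<open>The numbers \<open>n1\<close> and \<open>n2\<close> count the two ways in which an edge of the cut can send weight into a critical
  component, and the parity says that the component is odd. The inequality is trivial
  if both are positive, so it is a demand on the size of the cut when one of them is zero.\<close>

definition cut_condition :: bool where
  "cut_condition \<longleftrightarrow> (\<forall>U n1 n2. U \<subseteq> {v \<in> V. deg v = a + b} \<longrightarrow> U \<noteq> {} \<longrightarrow>
     n1 + n2 = card (leaving U) \<longrightarrow> odd (b * card U + n1) \<longrightarrow> a + b \<le> a * n1 + b * n2)"

lemma gadget_covered:
  assumes cut_condition
  shows "\<exists>M. G.covers nodes M"
proof (rule G.tutte_partial_weighted[of nodes weight])
  fix S C assume SC: "S \<subseteq> nodes" "C \<in> G.odd_comps (nodes - S)"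
  have "1 \<le> (\<Sum>x\<in>H. charge S C x)"
  proof (cases "\<exists>v. cores C v > 0 \<and> cores C v \<noteq> deg v - a")
    case True
    then obtain v where "cores C v > 0" "cores C v \<noteq> deg v - a" by blast
    then show ?thesis using charges_partial_vertex[OF SC, of v] cores_le(2)[OF SC, of v] by linarith
  next
    case False
    then have full: "\<And>v. cores C v > 0 \<Longrightarrow> cores C v = deg v - a" by blast
    show ?thesis
    proof (cases "\<exists>v. cores C v > 0")
      case True
      then obtain v0 where v0: "cores C v0 > 0" by blast
      show ?thesis
        using assms
        by (intro charges_full_vertices[OF SC, of v0] v0 full) (auto simp: cut_condition_def)
    qed (intro charges_no_core[OF SC], simp)
  qed
  then show "1 \<le> (\<Sum>c\<in>C. \<Sum>s\<in>S. weight s c)" using inflow_ge_charges[OF SC] by linarith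
qed (use finite_nodes weight_nonneg capacity in auto)

theorem split_half_edges:
  assumes cut_condition
  shows "\<exists>F\<subseteq>H. (\<forall>x\<in>F. flip x \<in> F) \<and>
    (\<forall>v\<in>V. a \<le> card {x \<in> F. base x = v} \<and> b \<le> card {x \<in> H - F. base x = v})"
proof -
  obtain M where M: "G.covers nodes M" using gadget_covered[OF assms] by blast
  then have edge: "\<And>e. e \<in> M \<Longrightarrow> \<exists>u w. e = {u, w} \<and> u \<noteq> w \<and> adj u w" and dis: "disjoint M"
    and sub: "\<Union>M \<subseteq> nodes" and cov: "nodes - optional \<subseteq> \<Union>M"
    by (auto simp: G.covers_def)
  have uniq: "w = w'" if "{u, w} \<in> M" "{u, w'} \<in> M" for u w w'
    using disjointD[OF dis that] by (auto simp: doubleton_eq_iff)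
  have partner: "\<exists>w. {u, w} \<in> M \<and> adj u w \<and> w \<in> nodes" if u: "u \<in> nodes" "u \<notin> optional" for u
  proof -
    obtain e where e: "e \<in> M" "u \<in> e" using cov u by blast
    then obtain p q where "e = {p, q}" "adj p q" using edge by blast
    then have "{u, p} \<in> M \<and> adj u p \<and> p \<in> nodes \<or> {u, q} \<in> M \<and> adj u q \<and> q \<in> nodes"
      using e sub G.adj_sym[of p q] by (auto simp: insert_commute[of q p])
    then show ?thesis by blast
  qed
  define F where "F = {x \<in> H. {Half x, Half (flip x)} \<in> M}"
  have "flip x \<in> F" if "x \<in> F" for x
    using that flip_in flip_flip by (auto simp: F_def insert_commute)
  moreover have "a \<le> card {x \<in> F. base x = v} \<and> b \<le> card {x \<in> H - F. base x = v}" if v: "v \<in> V" for v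
  proof
    let ?R = "{x \<in> H - F. base x = v}"
    have finR: "finite ?R" using finite_H by simp
    have "\<exists>j. {Half x, Core v j} \<in> M \<and> j < deg v - a" if x: "x \<in> ?R" for x
    proof -
      obtain w where "{Half x, w} \<in> M" "adj (Half x) w" "w \<in> nodes"
        using partner[of "Half x"] x by auto
      then show ?thesis using x by (cases w) (auto simp: F_def)
    qed
    then obtain g where g: "\<And>x. x \<in> ?R \<Longrightarrow> {Half x, Core v (g x)} \<in> M \<and> g x < deg v - a" by metis
    have "inj_on g ?R"
    proof (rule inj_onI)
      fix x y assume xy: "x \<in> ?R" "y \<in> ?R" "g x = g y"
      have "{Core v (g x), Half x} \<in> M" "{Core v (g x), Half y} \<in> M"
        using g[OF xy(1)] g[OF xy(2)] xy(3) by (simp_all add: insert_commute)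
      then show "x = y" using uniq by blast
    qed
    then have "card ?R \<le> card {..<deg v - a}" using g by (intro card_inj_on_le) auto
    moreover have "deg v = card {x \<in> F. base x = v} + card ?R"
    proof -
      have "halves v = {x \<in> F. base x = v} \<union> ?R" by (auto simp: halves_def F_def)
      then show ?thesis using finite_H by (simp, subst card_Un_disjoint) (auto simp: F_def)
    qed
    ultimately show "a \<le> card {x \<in> F. base x = v}" using deg_ge[OF v] by simp
    have "\<exists>x. {Half x, Core v j} \<in> M \<and> x \<in> ?R" if j: "j < b" for j
    proof -
      have "j < deg v - a" using j deg_ge[OF v] by linarith
      then obtain w where w: "{Core v j, w} \<in> M" "adj (Core v j) w" "w \<in> nodes"
        using partner[of "Core v j"] j v by auto
      then obtain x where x: "w = Half x" "x \<in> H" "base x = v" by (cases w) auto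
      have xM: "{Half x, Core v j} \<in> M" using w x by (simp add: insert_commute)
      then have "x \<notin> F" using uniq[of "Half x" "Core v j" "Half (flip x)"] by (auto simp: F_def)
      then show ?thesis using xM x by blast
    qed
    then obtain h where h: "\<And>j. j < b \<Longrightarrow> {Half (h j), Core v j} \<in> M \<and> h j \<in> ?R" by metis
    have "inj_on h {..<b}"
    proof (rule inj_onI)
      fix i j assume "i \<in> {..<b}" "j \<in> {..<b}" "h i = h j"
      then show "i = j" using uniq[of "Half (h i)" "Core v i" "Core v j"] h[of i] h[of j] by auto
    qed
    then have "card {..<b} \<le> card ?R" using h finR by (intro card_inj_on_le) auto
    then show "b \<le> card ?R" by simp
  qed
  ultimately show ?thesis by (intro exI[of _ F]) (auto simp: F_def)
qed

end

section \<open>Multigraphs as half-edge graphs\<close>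

text \<open>A choice of an orientation of every edge; \<open>False\<close> and \<open>True\<close> name the two ends, which coincide
  for a loop.\<close>

definition end_of :: "('v, 'e) multigraph \<Rightarrow> 'e \<Rightarrow> bool \<Rightarrow> 'v" where
  "end_of G = (SOME f. \<forall>e. ends G e = Upair (f e False) (f e True))"

lemma ends_end_of: "ends G e = Upair (end_of G e False) (end_of G e True)"
proof -
  have "\<exists>g. ends G e = Upair (g False) (g True)" for e
  proof (cases "ends G e")
    case (Upair u v)
    then show ?thesis by (intro exI[of _ "\<lambda>b. if b then v else u"]) simp
  qed
  then have "\<exists>f. \<forall>e. ends G e = Upair (f e False) (f e True)" by metis
  then show ?thesis unfolding end_of_def by (rule someI2_ex) blast
qed

text \<open>Both summands of the degree are accounted for: the edges at \<open>v\<close> are a union, the loops at \<open>v\<close> the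
  intersection, of the sets of edges whose first and whose second end is \<open>v\<close>. The end function is
  arbitrary so that a subgraph can use the one of the whole graph.\<close>

lemma degree_halves:
  assumes "finite (edges G)"
    and ends: "\<And>e. e \<in> edges G \<Longrightarrow> ends G e = Upair (f e False) (f e True)"
  shows "degree G v = card {x \<in> edges G \<times> UNIV. f (fst x) (snd x) = v}"
proof -
  let ?A = "\<lambda>b. {e \<in> edges G. f e b = v}"
  have fin: "finite (?A b)" for b using assms(1) by simp
  have "{x \<in> edges G \<times> UNIV. f (fst x) (snd x) = v} = ?A False \<times> {False} \<union> ?A True \<times> {True}"
  proof (rule set_eqI)
    show "x \<in> {x \<in> edges G \<times> UNIV. f (fst x) (snd x) = v} \<longleftrightarrow>
        x \<in> ?A False \<times> {False} \<union> ?A True \<times> {True}" for x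
      by (cases x; cases "snd x") auto
  qed
  also have "card \<dots> = card (?A False) + card (?A True)"
    using fin by (subst card_Un_disjoint) (auto simp: card_cartesian_product)
  also have "\<dots> = card (?A False \<union> ?A True) + card (?A False \<inter> ?A True)"
    by (rule card_Un_Int[OF fin fin])
  also have "?A False \<union> ?A True = {e \<in> edges G. v \<in> set_uprod (ends G e)}"
    using ends by auto
  also have "?A False \<inter> ?A True = {e \<in> edges G. ends G e = Upair v v}"
    using ends by auto
  finally show ?thesis by (simp add: degree_def)
qed

lemma min_degree_ge_iff:
  assumes "finite (verts G)" "verts G \<noteq> {}"
  shows "k \<le> min_degree G \<longleftrightarrow> (\<forall>v\<in>verts G. k \<le> degree G v)"
  using assms by (simp add: min_degree_def)

context fin_multigraph
begin

abbreviation half_edges :: "('e \<times> bool) set" where "half_edges \<equiv> edges G \<times> UNIV"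

definition origin :: "'e \<times> bool \<Rightarrow> 'v" where "origin x = end_of G (fst x) (snd x)"

definition flip :: "'e \<times> bool \<Rightarrow> 'e \<times> bool" where "flip x = (fst x, \<not> snd x)"

sublocale half: half_edge_graph "verts G" half_edges origin flip
proof
  show "origin x \<in> verts G" if "x \<in> half_edges" for x
    using that ends_in_verts[of "fst x"] ends_end_of[of G "fst x"]
    by (cases "snd x") (auto simp: origin_def)
qed (auto simp: flip_def finite_verts finite_edges)

lemma degree_eq_halves: "degree G v = card (half.halves v)"
  unfolding half.halves_def origin_def
  by (rule degree_halves[OF finite_edges ends_end_of])

lemma cut_degree_eq_leaving: "cut_degree G U = card (half.leaving U)"
proof -
  have "inj_on fst (half.leaving U)"
  proof (rule inj_onI)
    fix x y assume "x \<in> half.leaving U" "y \<in> half.leaving U" "fst x = fst y"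
    then show "x = y"
      by (cases x; cases y; cases "snd x"; cases "snd y")
         (auto simp: half.leaving_def flip_def origin_def)
  qed
  then have "card (half.leaving U) = card (fst ` half.leaving U)" by (rule card_image[symmetric])
  moreover have "fst ` half.leaving U =
      {e \<in> edges G. \<exists>u w. ends G e = Upair u w \<and> u \<in> U \<and> w \<notin> U}" (is "?L = ?R")
  proof
    show "?L \<subseteq> ?R"
    proof
      fix e assume "e \<in> ?L"
      then obtain b where b: "(e, b) \<in> half.leaving U" by auto
      have "ends G e = Upair (end_of G e b) (end_of G e (\<not> b))"
        using ends_end_of[of G e] by (cases b) auto
      then show "e \<in> ?R" using b by (auto simp: half.leaving_def flip_def origin_def)
    qed
    show "?R \<subseteq> ?L"
    proof
      fix e assume "e \<in> ?R"
      then obtain u w where e: "e \<in> edges G" "ends G e = Upair u w" "u \<in> U" "w \<notin> U" by blast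
      then have "u = end_of G e False \<and> w = end_of G e True \<or>
          u = end_of G e True \<and> w = end_of G e False"
        using ends_end_of[of G e] by auto
      then have "(e, False) \<in> half.leaving U \<or> (e, True) \<in> half.leaving U"
        using e(1,3,4) by (elim disjE) (simp_all add: half.leaving_def flip_def origin_def)
      then show "e \<in> ?L" by (metis fst_conv image_eqI)
    qed
  qed
  ultimately show ?thesis by (simp only: cut_degree_def)
qed

text \<open>The set of half-edges found by \<open>split_half_edges\<close> is closed under flipping, so it is a set of
  edges.\<close>

theorem edge_decomposition:
  assumes pos: "a > 0" "b > 0" and nonempty: "verts G \<noteq> {}" and deg: "a + b \<le> min_degree G"
    and cut: "\<And>U n1 n2. U \<subseteq> {v \<in> verts G. degree G v = a + b} \<Longrightarrow> U \<noteq> {} \<Longrightarrow>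
      n1 + n2 = cut_degree G U \<Longrightarrow> odd (b * card U + n1) \<Longrightarrow> a + b \<le> a * n1 + b * n2"
  shows "\<exists>G1 G2. edge_decomposed G G1 G2 \<and> min_degree G1 \<ge> a \<and> min_degree G2 \<ge> b"
proof -
  interpret split_gadget "verts G" half_edges origin flip a b
    using pos deg nonempty by unfold_locales
      (auto simp: min_degree_ge_iff[OF finite_verts] degree_eq_halves)
  have cut_condition
    using cut by (simp add: cut_condition_def degree_eq_halves cut_degree_eq_leaving)
  then obtain F where F: "F \<subseteq> half_edges" "\<And>x. x \<in> F \<Longrightarrow> flip x \<in> F"
    and degs: "\<And>v. v \<in> verts G \<Longrightarrow> a \<le> card {x \<in> F. origin x = v}"
      "\<And>v. v \<in> verts G \<Longrightarrow> b \<le> card {x \<in> half_edges - F. origin x = v}"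
    using split_half_edges by blast
  define sub where "sub D = G\<lparr>edges := D\<rparr>" for D
  let ?D = "fst ` F"
  have F_eq: "F = ?D \<times> UNIV"
  proof -
    have "(e, c) \<in> F" if "(e, b) \<in> F" for e b c
      using that F(2)[OF that] by (cases "b = c") (auto simp: flip_def)
    then show ?thesis by force
  qed
  have deg_sub: "degree (sub D) v = card {x \<in> D \<times> UNIV. origin x = v}" if "D \<subseteq> edges G" for D v
    unfolding origin_def using that finite_edges ends_end_of[of G]
    by (subst degree_halves[where f = "end_of G"]) (auto simp: sub_def intro: finite_subset)
  have D: "?D \<subseteq> edges G" using F(1) by auto
  have "half_edges - F = (edges G - ?D) \<times> UNIV" by (subst F_eq) auto
  then have "a \<le> min_degree (sub ?D)" "b \<le> min_degree (sub (edges G - ?D))"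
    using degs deg_sub D F_eq nonempty finite_verts
    by (simp_all add: min_degree_ge_iff sub_def)
  moreover have "edge_decomposed G (sub ?D) (sub (edges G - ?D))"
    using D by (auto simp: edge_decomposed_def factor_def sub_def)
  ultimately show ?thesis by blast
qed

lemma parity_cut_degree:
  assumes "U \<subseteq> verts G" "\<And>v. v \<in> U \<Longrightarrow> degree G v = k"
  shows "even (k * card U + cut_degree G U)"
  using half.parity_leaving[OF assms(1)] assms(2)
  by (simp add: degree_eq_halves cut_degree_eq_leaving mult.commute)

end

lemma ceiling_cut_bound:
  assumes "n \<ge> nat \<lceil>real d / real a\<rceil>" "a > 0" "a \<le> c"
  shows "d \<le> c * n"
proof -
  have "real d / real a \<le> real n" using assms(1) by linarith
  then have "real d \<le> real (a * n)" using assms(2) by (simp add: divide_le_eq mult.commute)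
  then have "d \<le> a * n" by linarith
  also have "\<dots> \<le> c * n" using assms(3) by simp
  finally show ?thesis .
qed

theorem corollary7p4:
  fixes G :: "('v, 'e) multigraph" and \<delta>1 \<delta>2 :: nat and V0 :: "'v set"
  assumes "\<delta>1 > 0" and "\<delta>2 > 0"
    and "fin_multigraph G" and "connected_graph G"
    and "V0 = {v \<in> verts G. degree G v = \<delta>1 + \<delta>2}"
    and "min_degree G \<ge> \<delta>1 + \<delta>2"
    and "(even \<delta>1 \<and> even \<delta>2)
       \<or> (odd \<delta>1 \<and> even \<delta>2 \<and>
          partially_odd_edge_connected G V0 (nat \<lceil>real (\<delta>1 + \<delta>2) / real \<delta>1\<rceil>))
       \<or> (odd \<delta>1 \<and> odd \<delta>2 \<and> (even (card (verts G)) \<or> V0 \<noteq> verts G) \<and>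
          partially_odd_set_edge_connected G V0
            (nat \<lceil>real (\<delta>1 + \<delta>2) / real (min \<delta>1 \<delta>2)\<rceil>) V0)"
  shows "\<exists>G1 G2. edge_decomposed G G1 G2 \<and> min_degree G1 \<ge> \<delta>1 \<and> min_degree G2 \<ge> \<delta>2"
proof -
  interpret fin_multigraph G by (rule assms(3))
  show ?thesis
  proof (rule edge_decomposition)
    show "verts G \<noteq> {}" using assms(4) by (simp add: connected_graph_def)
    fix U n1 n2
    assume U: "U \<subseteq> {v \<in> verts G. degree G v = \<delta>1 + \<delta>2}" "U \<noteq> {}"
      and n: "n1 + n2 = cut_degree G U" and odd: "odd (\<delta>2 * card U + n1)"
    have UV0: "U \<subseteq> V0" using U(1) assms(5) by simp
    have parity: "even ((\<delta>1 + \<delta>2) * card U + (n1 + n2))"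
      unfolding n using U(1) by (intro parity_cut_degree) auto
    \<comment> \<open>The parity of \<open>n1\<close> and that of the degree sum decide which of the hypotheses applies. If one of
      \<open>n1\<close>, \<open>n2\<close> vanishes, the set \<open>U\<close> has odd size and the other one is the whole cut.\<close>
    consider "n1 > 0" "n2 > 0" | "n1 = 0" | "n2 = 0" by blast
    then show "\<delta>1 + \<delta>2 \<le> \<delta>1 * n1 + \<delta>2 * n2"
    proof cases
      case 1
      then have "\<delta>1 * 1 \<le> \<delta>1 * n1" "\<delta>2 * 1 \<le> \<delta>2 * n2" by (intro mult_le_mono; simp)+
      then show ?thesis by linarith
    next
      case 2
      then have odds: "odd \<delta>2" "odd (card U)" using odd by auto
      then have "partially_odd_set_edge_connected G V0
          (nat \<lceil>real (\<delta>1 + \<delta>2) / real (min \<delta>1 \<delta>2)\<rceil>) V0"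
        using assms(7) by auto
      moreover have "U \<inter> V0 = U" using UV0 by auto
      ultimately have "nat \<lceil>real (\<delta>1 + \<delta>2) / real (min \<delta>1 \<delta>2)\<rceil> \<le> n2"
        using UV0 odds n 2 by (metis partially_odd_set_edge_connected_def add_0)
      then have "\<delta>1 + \<delta>2 \<le> \<delta>2 * n2"
        using assms(1,2) by (intro ceiling_cut_bound[where a = "min \<delta>1 \<delta>2"]) auto
      then show ?thesis by simp
    next
      case 3
      then have odds: "odd \<delta>1" "odd (card U)" and n1: "n1 = cut_degree G U"
        using odd parity n by auto
      show ?thesis
      proof (cases "even \<delta>2")
        case True
        then have "partially_odd_edge_connected G V0 (nat \<lceil>real (\<delta>1 + \<delta>2) / real \<delta>1\<rceil>)"
          and "odd n1"
          using assms(7) odds odd by auto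
        then have "nat \<lceil>real (\<delta>1 + \<delta>2) / real \<delta>1\<rceil> \<le> n1"
          using UV0 U(2) n1 by (auto simp: partially_odd_edge_connected_def)
        then have "\<delta>1 + \<delta>2 \<le> \<delta>1 * n1"
          using assms(1) by (intro ceiling_cut_bound[where a = \<delta>1]) auto
        then show ?thesis by simp
      next
        case False
        then have "partially_odd_set_edge_connected G V0
            (nat \<lceil>real (\<delta>1 + \<delta>2) / real (min \<delta>1 \<delta>2)\<rceil>) V0"
          using assms(7) by auto
        moreover have "U \<inter> V0 = U" using UV0 by auto
        ultimately have "nat \<lceil>real (\<delta>1 + \<delta>2) / real (min \<delta>1 \<delta>2)\<rceil> \<le> n1"
          using UV0 odds n1 by (metis partially_odd_set_edge_connected_def)
        then have "\<delta>1 + \<delta>2 \<le> \<delta>1 * n1"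
          using assms(1,2) by (intro ceiling_cut_bound[where a = "min \<delta>1 \<delta>2"]) auto
        then show ?thesis by simp
      qed
    qed
  qed (use assms in auto)
qed

end
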